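(* Let $A$ be a discrete 1-form with real components $A^1_{k,s},A^2_{k,s}$. The discrete magnetic Laplacian $-\Delta^c_A=\delta^c_A d^c_A:H^0\to H^0$ is self-adjoint, i.e. for all $\varphi,\psi\in H^0$, $$(\delta^c_A d^c_A\varphi,\ \psi)_V=(\varphi,\ \delta^c_A d^c_A\psi)_V .$$
   Context: Fix positive integers $N,M$. $H^0$ is the space of discrete 0-forms $\varphi=\sum\varphi_{k,s}x^{k,s}$ with complex components $\varphi_{k,s}$, $1\le k\le N$, $1\le s\le M$, with inner product $(\varphi,\psi)_V=\sum_{k=1}^N\sum_{s=1}^M\varphi_{k,s}\overline{\psi_{k,s}}$. Every $\varphi\in H^0$ is extended by the (Dirichlet) boundary conditions $\varphi_{0,s}=\varphi_{N+1,s}=0$, $\varphi_{k,0}=\varphi_{k,M+1}=0$ for $1\le k\le N$, $1\le s\le M$. For such $\varphi$, $d^c_A\varphi=(u,v)$ is the discrete 1-form with components $u_{k,s}=\varphi_{k+1,s}-\varphi_{k,s}+i\varphi_{k,s}A^1_{k,s}$ for $0\le k\le N$, $1\le s\le M$, and $v_{k,s}=\varphi_{k,s+1}-\varphi_{k,s}+i\varphi_{k,s}A^2_{k,s}$ for $1\le k\le N$, $0\le s\le M$ (the values $A^1_{0,s},A^2_{k,0}$ are irrelevant since they multiply zero). For a 1-form $\omega=(u,v)$, $\delta^c_A\omega$ is the 0-form with components $$(\delta^c_A\omega)_{k,s}=-(u_{k,s}-u_{k-1,s})-(v_{k,s}-v_{k,s-1})-i(A^1_{k,s}u_{k,s}+A^2_{k,s}v_{k,s}),\quad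 1\le k\le N,\ 1\le s\le M.$$ *)

theory Defs
  imports Complex_Main "HOL-Library.FuncSet"
begin

text \<open>
  A discrete form is given by its components. Only the index ranges named below carry
  information, so total functions on \<open>nat \<times> nat\<close> are used throughout. A 1-form
  is the pair (u, v) of its two component families.
\<close>

type_synonym 'a form0 = "nat \<Rightarrow> nat \<Rightarrow> 'a"
type_synonym 'a form1 = "'a form0 \<times> 'a form0"

text \<open>
  A form with components \<open>\<phi> k s\<close>, \<open>1 \<le> k \<le> N\<close>, \<open>1 \<le> s \<le> M\<close>, is represented by its
  extension by zero. This contains the Dirichlet conditions at \<open>k = 0\<close>, \<open>k = N + 1\<close>,
  \<open>s = 0\<close> and \<open>s = M + 1\<close>; vanishing at all further indices makes the representation unique.
\<close>

definition H0 :: "nat \<Rightarrow> nat \<Rightarrow> complex form0 set" where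
  "H0 N M = {\<phi>. \<forall>k s. \<not> (k \<in> {1..N} \<and> s \<in> {1..M}) \<longrightarrow> \<phi> k s = 0}"

definition inner_V :: "nat \<Rightarrow> nat \<Rightarrow> complex form0 \<Rightarrow> complex form0 \<Rightarrow> complex" where
  "inner_V N M \<phi> \<psi> = (\<Sum>k = 1..N. \<Sum>s = 1..M. \<phi> k s * cnj (\<psi> k s))"

text \<open>
  For \<open>\<phi> \<in> H0 N M\<close> the formulas below give zero outside the ranges \<open>0 \<le> k \<le> N\<close>,
  \<open>1 \<le> s \<le> M\<close> (for \<open>u\<close>) and \<open>1 \<le> k \<le> N\<close>, \<open>0 \<le> s \<le> M\<close> (for \<open>v\<close>), so no case
  distinction is needed.
\<close>

definition d_mag :: "real form1 \<Rightarrow> complex form0 \<Rightarrow> complex form1" where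
  "d_mag A \<phi> =
     (\<lambda>k s. \<phi> (k + 1) s - \<phi> k s + \<i> * \<phi> k s * complex_of_real (fst A k s),
      \<lambda>k s. \<phi> k (s + 1) - \<phi> k s + \<i> * \<phi> k s * complex_of_real (snd A k s))"

text \<open>The truncated subtractions are only evaluated at \<open>k, s \<ge> 1\<close>.\<close>

definition delta_mag ::
    "nat \<Rightarrow> nat \<Rightarrow> real form1 \<Rightarrow> complex form1 \<Rightarrow> complex form0" where
  "delta_mag N M A \<omega> = (\<lambda>k s.
     if k \<in> {1..N} \<and> s \<in> {1..M} then
       - (fst \<omega> k s - fst \<omega> (k - 1) s) - (snd \<omega> k s - snd \<omega> k (s - 1))
       - \<i> * (complex_of_real (fst A k s) * fst \<omega> k s + complex_of_real (snd A k s) * snd \<omega> k s)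
     else 0)"

text \<open>The operator \<open>-\<Delta>\<close>, with the sign included.\<close>

definition neg_laplacian_mag ::
    "nat \<Rightarrow> nat \<Rightarrow> real form1 \<Rightarrow> complex form0 \<Rightarrow> complex form0" where
  "neg_laplacian_mag N M A \<phi> = delta_mag N M A (d_mag A \<phi>)"

end

theory Submission imports Defs begin

text \<open>
  Summation by parts shows that \<open>\<delta>\<close> is the formal adjoint of \<open>d\<close> on forms satisfying the
  Dirichlet conditions; the term \<open>- \<i> A u\<close> is what conjugation makes of \<open>\<i> A \<psi>\<close>, since \<open>A\<close>
  is real. Hence the inner product of \<open>\<delta> d \<phi>\<close> with \<open>\<psi>\<close> is the Hermitian form of \<open>d \<phi>\<close> and \<open>d \<psi>\<close>.
\<close>

text \<open>Induction on \<open>n\<close>, with the boundary term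
  \<open>u n * cnj (g (n + 1))\<close> carried along: in the step, the shifted part of the new
  summand is exactly the previous boundary term. The base case rests on
  \<open>g 0 = 0\<close>.\<close>

lemma magnetic_summation_by_parts:
  fixes u g :: "nat \<Rightarrow> complex" and a :: "nat \<Rightarrow> real"
  assumes "g 0 = 0"
  shows "(\<Sum>k = 1..n. (- (u k - u (k - 1)) - \<i> * (of_real (a k) * u k)) * cnj (g k))
         + u n * cnj (g (n + 1))
       = (\<Sum>k = 0..n. u k * cnj (g (k + 1) - g k + \<i> * g k * of_real (a k)))"
proof (induction n)
  case 0
  then show ?case using assms by simp
next
  case (Suc n)
  show ?case
    unfolding sum.atLeast0_atMost_Suc Suc.IH[symmetric] by (simp add: algebra_simps)
qed

text \<open>The ranges start at \<open>k = 0\<close> for the first component and at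
  \<open>s = 0\<close> for the second, since \<open>d_mag\<close> of a form in \<open>H0 N M\<close>
  need not vanish there.\<close>

definition inner_form1 :: "nat \<Rightarrow> nat \<Rightarrow> complex form1 \<Rightarrow> complex form1 \<Rightarrow> complex" where
  "inner_form1 N M \<omega> \<eta> =
     (\<Sum>k = 0..N. \<Sum>s = 1..M. fst \<omega> k s * cnj (fst \<eta> k s)) +
     (\<Sum>k = 1..N. \<Sum>s = 0..M. snd \<omega> k s * cnj (snd \<eta> k s))"

lemma cnj_inner_V: "cnj (inner_V N M \<phi> \<psi>) = inner_V N M \<psi> \<phi>"
  by (simp add: inner_V_def mult.commute)

lemma cnj_inner_form1: "cnj (inner_form1 N M \<omega> \<eta>) = inner_form1 N M \<eta> \<omega>"
  by (simp add: inner_form1_def mult.commute)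

lemma delta_mag_in_H0: "delta_mag N M A \<omega> \<in> H0 N M"
  by (auto simp: delta_mag_def H0_def)

lemma inner_V_delta_mag:
  assumes "\<psi> \<in> H0 N M"
  shows "inner_V N M (delta_mag N M A \<omega>) \<psi> = inner_form1 N M \<omega> (d_mag A \<psi>)"
proof -
  obtain u v where \<omega>: "\<omega> = (u, v)" by (cases \<omega>)
  obtain a b where A: "A = (a, b)" by (cases A)
  have zero: "\<psi> 0 s = 0" "\<psi> (N + 1) s = 0" "\<psi> k 0 = 0" "\<psi> k (M + 1) = 0" for k s
    using assms by (auto simp: H0_def)
  let ?U = "\<lambda>k s. (- (u k s - u (k - 1) s) - \<i> * (of_real (a k s) * u k s)) * cnj (\<psi> k s)"
  let ?V = "\<lambda>k s. (- (v k s - v k (s - 1)) - \<i> * (of_real (b k s) * v k s)) * cnj (\<psi> k s)"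
  \<comment> \<open>Here \<open>s\<close> is fixed; the boundary term left over at
    \<open>k = N\<close> contains \<open>\<psi> (N + 1) s\<close> and vanishes.\<close>
  have U: "(\<Sum>k = 1..N. ?U k s) =
      (\<Sum>k = 0..N. u k s * cnj (\<psi> (k + 1) s - \<psi> k s + \<i> * \<psi> k s * of_real (a k s)))" for s
    using magnetic_summation_by_parts
        [where g = "\<lambda>k. \<psi> k s" and u = "\<lambda>k. u k s" and a = "\<lambda>k. a k s" and n = N, OF zero(1)]
    unfolding zero(2) by simp
  have V: "(\<Sum>s = 1..M. ?V k s) =
      (\<Sum>s = 0..M. v k s * cnj (\<psi> k (s + 1) - \<psi> k s + \<i> * \<psi> k s * of_real (b k s)))" for k
    using magnetic_summation_by_parts[where g = "\<psi> k" and u = "v k" and a = "b k" and n = M, OF zero(3)]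
    unfolding zero(4) by simp
  have "inner_V N M (delta_mag N M A \<omega>) \<psi> = (\<Sum>k = 1..N. \<Sum>s = 1..M. ?U k s + ?V k s)"
    unfolding inner_V_def \<omega> A
    by (intro sum.cong refl) (simp add: delta_mag_def algebra_simps)
  \<comment> \<open>The first double sum is reordered so that its inner sum runs in the direction of
    the differences, as \<open>U\<close> requires.\<close>
  also have "\<dots> = (\<Sum>s = 1..M. \<Sum>k = 1..N. ?U k s) + (\<Sum>k = 1..N. \<Sum>s = 1..M. ?V k s)"
    unfolding sum.distrib add_right_cancel by (rule sum.swap)
  also have "\<dots> = inner_form1 N M \<omega> (d_mag A \<psi>)"
    unfolding U V inner_form1_def d_mag_def \<omega> A fst_conv snd_conv add_right_cancel
    by (rule sum.swap)
  finally show ?thesis .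
qed

theorem proposition3p3:
  fixes N M :: nat and A :: "real form1"
  assumes "N \<ge> 1" and "M \<ge> 1"
  shows "neg_laplacian_mag N M A \<in> H0 N M \<rightarrow> H0 N M \<and>
    (\<forall>\<phi>\<in>H0 N M. \<forall>\<psi>\<in>H0 N M.
       inner_V N M (neg_laplacian_mag N M A \<phi>) \<psi> = inner_V N M \<phi> (neg_laplacian_mag N M A \<psi>))"
proof (intro conjI ballI)
  show "neg_laplacian_mag N M A \<in> H0 N M \<rightarrow> H0 N M"
    by (simp add: neg_laplacian_mag_def delta_mag_in_H0)
next
  fix \<phi> \<psi> assume \<phi>: "\<phi> \<in> H0 N M" and \<psi>: "\<psi> \<in> H0 N M"
  have "inner_V N M (neg_laplacian_mag N M A \<phi>) \<psi> = inner_form1 N M (d_mag A \<phi>) (d_mag A \<psi>)"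
    unfolding neg_laplacian_mag_def by (rule inner_V_delta_mag[OF \<psi>])
  \<comment> \<open>Hermitian symmetry exchanges the two forms, so that the adjoint relation applies
    again, now tested against \<phi>.\<close>
  also have "\<dots> = cnj (inner_form1 N M (d_mag A \<psi>) (d_mag A \<phi>))"
    by (simp only: cnj_inner_form1)
  also have "\<dots> = cnj (inner_V N M (neg_laplacian_mag N M A \<psi>) \<phi>)"
    unfolding neg_laplacian_mag_def by (simp only: inner_V_delta_mag[OF \<phi>])
  also have "\<dots> = inner_V N M \<phi> (neg_laplacian_mag N M A \<psi>)"
    by (rule cnj_inner_V)
  finally show "inner_V N M (neg_laplacian_mag N M A \<phi>) \<psi> =
      inner_V N M \<phi> (neg_laplacian_mag N M A \<psi>)" .
qed

end
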